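(* Let $0<a<b<+\infty$ and let $\mathcal C_{[a,b]}$ be the classical ternary Cantor set on the interval $[a,b]$. Let $T$ be an operator on a separable infinite-dimensional Banach space $X$. Then the family $(\lambda T)_{\lambda\in\mathcal C_{[a,b]}}$ has no common upper frequently hypercyclic vector.
   Context: An operator is a continuous linear self-map. For $A\subset\mathbb N_0$, $\overline d(A)=\limsup_{n\to\infty}\frac{\#(A\cap[0,n])}{n+1}$. A vector $u\in X$ is upper frequently hypercyclic for an operator $S$ on $X$ if $\overline d(\{k\in\mathbb N_0:S^ku\in U\})>0$ for every non-empty open $U\subset X$; a common upper frequently hypercyclic vector for a family is one that is upper frequently hypercyclic for every member. $\mathcal C_{[a,b]}$ is the image of the standard middle-thirds Cantor set in $[0,1]$ under $t\mapsto a+(b-a)t$. *)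

theory Defs
  imports "HOL-Analysis.Analysis"
begin

definition upper_density :: "nat set \<Rightarrow> ereal" where
  "upper_density A = limsup (\<lambda>n. ereal (real (card (A \<inter> {0..n})) / real (n + 1)))"

definition upper_freq_hypercyclic :: "('a::real_normed_vector \<Rightarrow> 'a) \<Rightarrow> 'a \<Rightarrow> bool" where
  "upper_freq_hypercyclic S u \<longleftrightarrow>
     (\<forall>U. open U \<and> U \<noteq> {} \<longrightarrow> upper_density {k. (S ^^ k) u \<in> U} > 0)"

definition common_upper_freq_hypercyclic ::
    "('i \<Rightarrow> 'a::real_normed_vector \<Rightarrow> 'a) \<Rightarrow> 'i set \<Rightarrow> 'a \<Rightarrow> bool" where
  "common_upper_freq_hypercyclic F I u \<longleftrightarrow> (\<forall>i\<in>I. upper_freq_hypercyclic (F i) u)"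

(* The union of the 2^n closed intervals left after n removals of open middle
   thirds, starting from [0,1]: stage n + 1 consists of two copies of stage n,
   scaled by 1/3 and placed at 0 and at 2/3. *)
primrec cantor_stage :: "nat \<Rightarrow> real set" where
  "cantor_stage 0 = {0..1}"
| "cantor_stage (Suc n) =
     (\<lambda>t. t / 3) ` cantor_stage n \<union> (\<lambda>t. 2 / 3 + t / 3) ` cantor_stage n"

definition cantor_set :: "real set" where
  "cantor_set = (\<Inter>n. cantor_stage n)"

definition cantor_set_on :: "real \<Rightarrow> real \<Rightarrow> real set" where
  "cantor_set_on a b = (\<lambda>t. a + (b - a) * t) ` cantor_set"

(* No linear independence is required of the finite spanning set B; a type has
   a finite spanning set iff it has a finite basis.  For a complex Banach space
   viewed as a real one, this agrees with infinite dimension over the complex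
   numbers. *)
definition infinite_dimensional :: "'a::real_vector itself \<Rightarrow> bool" where
  "infinite_dimensional _ \<longleftrightarrow> \<not> (\<exists>B::'a set. finite B \<and> span B = UNIV)"

end

theory Submission
  imports Defs
begin

text \<open>
  For a fixed vector \<open>u\<close>, let \<open>U\<close> be the open annulus of vectors of norm between 1 and 2, and let
  \<open>I k\<close> be the open set of parameters \<open>\<lambda>\<close> for which \<open>(\<lambda>T)\<^sup>k u = \<lambda>\<^sup>k T\<^sup>k u\<close> lies in \<open>U\<close>. On \<open>[a,b]\<close> the
  condition says that \<open>\<lambda>\<^sup>k\<close> lies in an interval whose endpoints have ratio 2, so the diameter of
  \<open>I k \<inter> [a,b]\<close> is at most \<open>b / k\<close> (Bernoulli's inequality, lemma \<open>power_window_diameter\<close>).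

  The Cantor set has positive dimension: a set of diameter \<open>\<delta>\<close> carries at most the fraction
  \<open>2 sqrt \<delta>\<close> of its natural measure, so the set \<open>I k\<close> carries \<open>O(k powr (-1/2))\<close> of it. Hence the
  integral of \<open>\<Sum>k. of_bool (\<lambda> \<in> I k) / k\<close> is at most a constant times \<open>\<Sum>k. k powr (-3/2)\<close>, which is
  finite, and there is \<open>\<lambda>\<close> in the Cantor set whose set of visiting times \<open>{k. \<lambda> \<in> I k}\<close> has a
  convergent sum of reciprocals (lemma \<open>cantor_point_with_sparse_visits\<close>). Such a set of times has
  upper density zero (lemma \<open>upper_density_le_zero_of_summable_reciprocals\<close>), so \<open>u\<close> is not upper
  frequently hypercyclic for \<open>\<lambda>T\<close>.

  The natural measure is replaced by the uniform distribution on the \<open>2 ^ n\<close> left endpoints of the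
  intervals of stage \<open>n\<close>. Averaging over them controls finitely many times \<open>k\<close>; compactness
  of the Cantor set and openness of the sets \<open>I k\<close> then give one point that works for all \<open>k\<close>.
\<close>

section \<open>Left endpoints in the Cantor set\<close>

lemma cantor_stage_subset: "cantor_stage n \<subseteq> {0..1}"
  by (induction n) auto

lemma compact_cantor_stage: "compact (cantor_stage n)"
proof (induction n)
  case (Suc n)
  then show ?case
    by (auto intro!: compact_Un compact_continuous_image continuous_intros)
qed auto

lemma compact_cantor_set: "compact cantor_set"
  unfolding cantor_set_def
  using compact_cantor_stage by (intro compact_Inter) auto

lemma cantor_set_subset: "cantor_set \<subseteq> {0..1}"
  using cantor_stage_subset[of 0] unfolding cantor_set_def by blast

lemma cantor_set_third:
  assumes "t \<in> cantor_set"
  shows "t / 3 \<in> cantor_set" and "2 / 3 + t / 3 \<in> cantor_set"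
proof -
  have t: "0 \<le> t" "t \<le> 1"
    using assms cantor_set_subset by auto
  have "t / 3 \<in> cantor_stage n \<and> 2 / 3 + t / 3 \<in> cantor_stage n" for n
    using assms t by (cases n) (auto simp: cantor_set_def)
  then show "t / 3 \<in> cantor_set" "2 / 3 + t / 3 \<in> cantor_set"
    by (auto simp: cantor_set_def)
qed

primrec cantor_left_endpoints :: "nat \<Rightarrow> real set" where
  "cantor_left_endpoints 0 = {0}"
| "cantor_left_endpoints (Suc n) =
     (\<lambda>t. t / 3) ` cantor_left_endpoints n \<union> (\<lambda>t. 2 / 3 + t / 3) ` cantor_left_endpoints n"

lemma zero_in_cantor_set: "0 \<in> cantor_set"
proof -
  have "0 \<in> cantor_stage n" for n
    by (induction n) auto
  then show ?thesis
    by (auto simp: cantor_set_def)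
qed

lemma cantor_left_endpoints_subset: "cantor_left_endpoints n \<subseteq> cantor_set"
  by (induction n) (auto simp: zero_in_cantor_set cantor_set_third)

lemma cantor_left_endpoints_bounds:
  "t \<in> cantor_left_endpoints n \<Longrightarrow> 0 \<le> t \<and> t \<le> 1"
  using cantor_left_endpoints_subset cantor_set_subset by fastforce

lemma finite_cantor_left_endpoints: "finite (cantor_left_endpoints n)"
  by (induction n) auto

lemma card_cantor_left_endpoints: "card (cantor_left_endpoints n) = 2 ^ n"
proof (induction n)
  case (Suc n)
  let ?E = "cantor_left_endpoints n"
  have "(\<lambda>t. t / 3) ` ?E \<inter> (\<lambda>t. 2 / 3 + t / 3) ` ?E = {}"
    by (auto dest!: cantor_left_endpoints_bounds)
  then have "card (cantor_left_endpoints (Suc n)) =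
      card ((\<lambda>t. t / 3) ` ?E) + card ((\<lambda>t. 2 / 3 + t / 3) ` ?E)"
    by (simp add: card_Un_disjoint finite_cantor_left_endpoints)
  also have "\<dots> = 2 ^ Suc n"
    using Suc by (simp add: card_image inj_on_def)
  finally show ?case .
qed simp

text \<open>
  This is the positive dimension of the Cantor set. The two thirds of \<open>[0,1]\<close> that carry the
  Cantor set are at distance \<open>1/3\<close>, so a set of diameter less than \<open>\<delta> \<le> 1/3\<close> meets only one of
  them, and blowing it up by 3 halves the total number of points while \<open>\<delta>\<close> becomes \<open>3\<delta>\<close>. The bound
  survives because \<open>sqrt 3 \<le> 2\<close>.
  The condition \<open>1 \<le> 3 ^ n * \<delta>\<close> says that the \<open>n\<close>-th stage resolves the scale \<open>\<delta>\<close>.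
\<close>

lemma card_cantor_left_endpoints_Int_le:
  assumes "1 \<le> 3 ^ n * \<delta>"
    and "\<And>s t. s \<in> cantor_left_endpoints n \<inter> S \<Longrightarrow> t \<in> cantor_left_endpoints n \<inter> S \<Longrightarrow>
           \<bar>s - t\<bar> < \<delta>"
  shows "real (card (cantor_left_endpoints n \<inter> S)) \<le> 2 ^ n * (2 * sqrt \<delta>)"
  using assms
proof (induction n arbitrary: \<delta> S)
  case 0
  have "card ({0} \<inter> S) \<le> card {0::real}"
    by (intro card_mono) auto
  then have "real (card ({0} \<inter> S)) \<le> 1"
    by simp
  moreover have "1 \<le> sqrt \<delta>"
    using 0 by simp
  ultimately show ?case
    unfolding cantor_left_endpoints.simps power_0 by linarith
next
  case (Suc n)
  let ?E = "cantor_left_endpoints n" and ?E' = "cantor_left_endpoints (Suc n)"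
  show ?case
  proof (cases "\<delta> \<ge> 1 / 3")
    case True
    \<comment> \<open>At this scale the bound exceeds the total number of points.\<close>
    have "1 / 2 \<le> sqrt \<delta>"
      using True by (intro real_le_rsqrt) (simp add: power2_eq_square)
    moreover have "real (card (?E' \<inter> S)) \<le> 2 ^ Suc n"
      using card_mono[OF finite_cantor_left_endpoints, of "?E' \<inter> S" "Suc n"]
      unfolding card_cantor_left_endpoints
      by (metis Int_lower1 of_nat_le_iff of_nat_numeral of_nat_power)
    moreover have "(2::real) ^ Suc n * 1 \<le> 2 ^ Suc n * (2 * sqrt \<delta>)"
      using \<open>1 / 2 \<le> sqrt \<delta>\<close> by (intro mult_left_mono) auto
    ultimately show ?thesis
      by linarith
  next
    case False
    have one_third: "real (card (?E' \<inter> S)) \<le> 2 ^ Suc n * (2 * sqrt \<delta>)"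
      if sub: "?E' \<inter> S \<subseteq> (\<lambda>t. c + t / 3) ` (?E \<inter> {t. c + t / 3 \<in> S})"
        and mem: "(\<lambda>t. c + t / 3) ` ?E \<subseteq> ?E'" for c
    proof -
      let ?S = "{t. c + t / 3 \<in> S}"
      have "\<delta> \<ge> 0"
        using Suc.prems(1) by (smt (verit) mult_pos_neg zero_less_power)
      have "card (?E' \<inter> S) \<le> card ((\<lambda>t. c + t / 3) ` (?E \<inter> ?S))"
        using sub by (intro card_mono) (auto simp: finite_cantor_left_endpoints)
      also have "\<dots> \<le> card (?E \<inter> ?S)"
        by (intro card_image_le) (auto simp: finite_cantor_left_endpoints)
      finally have "real (card (?E' \<inter> S)) \<le> card (?E \<inter> ?S)"
        by simp
      also have "\<dots> \<le> 2 ^ n * (2 * sqrt (3 * \<delta>))"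
      proof (rule Suc.IH)
        show "1 \<le> 3 ^ n * (3 * \<delta>)"
          using Suc.prems(1) by (simp add: mult_ac)
        fix s t assume "s \<in> ?E \<inter> ?S" "t \<in> ?E \<inter> ?S"
        then have "\<bar>(c + s / 3) - (c + t / 3)\<bar> < \<delta>"
          using mem by (intro Suc.prems(2)) auto
        then show "\<bar>s - t\<bar> < 3 * \<delta>"
          by linarith
      qed
      also have "\<dots> \<le> 2 ^ n * (2 * sqrt (2\<^sup>2 * \<delta>))"
        using \<open>\<delta> \<ge> 0\<close> by (intro mult_left_mono real_sqrt_le_mono mult_right_mono) auto
      also have "\<dots> = 2 ^ Suc n * (2 * sqrt \<delta>)"
        by (simp add: real_sqrt_mult)
      finally show ?thesis .
    qed
    have "?E' \<inter> S \<subseteq> (\<lambda>t. t / 3) ` ?E \<or> ?E' \<inter> S \<subseteq> (\<lambda>t. 2 / 3 + t / 3) ` ?E"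
    proof (rule ccontr)
      assume "\<not> ?thesis"
      then obtain s t where "s \<in> ?E" "t \<in> ?E" "s / 3 \<in> ?E' \<inter> S" "2 / 3 + t / 3 \<in> ?E' \<inter> S"
        by auto
      moreover from this have "\<bar>s / 3 - (2 / 3 + t / 3)\<bar> < \<delta>"
        using Suc.prems(2) by blast
      ultimately show False
        using False cantor_left_endpoints_bounds[of s n] cantor_left_endpoints_bounds[of t n]
        by linarith
    qed
    then show ?thesis
    proof
      assume "?E' \<inter> S \<subseteq> (\<lambda>t. t / 3) ` ?E"
      then show ?thesis
        by (intro one_third[of 0]) auto
    next
      assume "?E' \<inter> S \<subseteq> (\<lambda>t. 2 / 3 + t / 3) ` ?E"
      then show ?thesis
        by (intro one_third[of "2 / 3"]) auto
    qed
  qed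
qed

section \<open>Points of the Cantor set in few members of a shrinking sequence of sets\<close>

text \<open>
  An average over the endpoints of a sufficiently fine stage: the set \<open>I k\<close> contains at most a
  fraction \<open>2 sqrt (D / k)\<close> of them, so the average of the sum is at most the right-hand side, and
  some endpoint does no worse than the average.
\<close>

lemma cantor_point_with_few_visits:
  assumes "D > 0"
    and diam: "\<And>k s t. s \<in> I k \<inter> cantor_set \<Longrightarrow> t \<in> I k \<inter> cantor_set \<Longrightarrow> \<bar>s - t\<bar> * real k < D"
  shows "\<exists>t\<in>cantor_set.
           (\<Sum>k<N. of_bool (t \<in> I k) / real k) \<le> (\<Sum>k<N. 2 * sqrt D * real k powr (-3/2))"
proof -
  obtain n where n: "real N / D < 3 ^ n"
    using real_arch_pow[of 3 "real N / D"] by auto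
  let ?E = "cantor_left_endpoints n"
  have term_le: "real (card (?E \<inter> I k)) / real k \<le> 2 ^ n * (2 * sqrt D * real k powr (-3/2))"
    if "k < N" for k
  proof (cases "k = 0")
    case False
    have "real k \<le> 3 ^ n * D"
      using n that \<open>D > 0\<close> by (simp add: field_simps)
    then have "real (card (?E \<inter> I k)) \<le> 2 ^ n * (2 * sqrt (D / real k))"
      using diam[of _ k] False cantor_left_endpoints_subset
      by (intro card_cantor_left_endpoints_Int_le) (auto simp: field_simps subset_iff)
    then have "real (card (?E \<inter> I k)) / real k \<le> 2 ^ n * (2 * sqrt (D / real k)) / real k"
      by (intro divide_right_mono) auto
    also have "\<dots> = 2 ^ n * (2 * sqrt D * real k powr (-3/2))"
    proof -
      have "real k powr (-3/2) = real k powr (-(1/2)) * real k powr (-1)"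
        unfolding powr_add[symmetric] by simp
      also have "\<dots> = 1 / sqrt (real k) / real k"
        using False by (simp add: powr_minus powr_half_sqrt field_simps)
      finally show ?thesis
        by (simp add: real_sqrt_divide)
    qed
    finally show ?thesis .
  qed simp
  let ?M = "\<Sum>k<N. 2 * sqrt D * real k powr (-3/2)"
  have "(\<Sum>t\<in>?E. \<Sum>k<N. of_bool (t \<in> I k) / real k) = (\<Sum>k<N. \<Sum>t\<in>?E. of_bool (t \<in> I k) / real k)"
    by (rule sum.swap)
  also have "\<dots> = (\<Sum>k<N. real (card (?E \<inter> I k)) / real k)"
    by (simp add: finite_cantor_left_endpoints Int_def flip: sum_divide_distrib)
  also have "\<dots> \<le> (\<Sum>k<N. 2 ^ n * (2 * sqrt D * real k powr (-3/2)))"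
    using term_le by (intro sum_mono) auto
  also have "\<dots> = (\<Sum>t\<in>?E. ?M)"
    by (simp add: card_cantor_left_endpoints flip: sum_distrib_left)
  finally have total: "(\<Sum>t\<in>?E. \<Sum>k<N. of_bool (t \<in> I k) / real k) \<le> (\<Sum>t\<in>?E. ?M)" .
  have "?E \<noteq> {}"
    using card_cantor_left_endpoints[of n] by force
  have "\<exists>t\<in>?E. (\<Sum>k<N. of_bool (t \<in> I k) / real k) \<le> ?M"
  proof (rule ccontr)
    assume "\<not> ?thesis"
    then have "(\<Sum>t\<in>?E. ?M) < (\<Sum>t\<in>?E. \<Sum>k<N. of_bool (t \<in> I k) / real k)"
      by (intro sum_strict_mono[OF finite_cantor_left_endpoints \<open>?E \<noteq> {}\<close>]) (metis not_le)
    with total show False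
      by simp
  qed
  then show ?thesis
    using cantor_left_endpoints_subset by blast
qed

text \<open>
  Since the \<open>I k\<close> are open, a limit of points belongs to \<open>I k\<close> only if almost all of the points
  do, so the bounds on partial sums pass to a cluster point of the points given by
  \<open>cantor_point_with_few_visits\<close>.
\<close>

lemma cantor_point_with_sparse_visits:
  assumes "D > 0" and "\<And>k. open (I k)"
    and diam: "\<And>k s t. s \<in> I k \<inter> cantor_set \<Longrightarrow> t \<in> I k \<inter> cantor_set \<Longrightarrow> \<bar>s - t\<bar> * real k < D"
  shows "\<exists>t\<in>cantor_set. summable (\<lambda>k. of_bool (t \<in> I k) / real k)"
proof -
  let ?g = "\<lambda>k. 2 * sqrt D * real k powr (-3/2)"
  let ?M = "suminf ?g"
  have "summable ?g"
    by (intro summable_mult) (simp add: summable_real_powr_iff)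
  then have g_le: "(\<Sum>k<N. ?g k) \<le> ?M" for N
    using \<open>D > 0\<close> by (intro sum_le_suminf) auto
  have "\<exists>t\<in>cantor_set. (\<Sum>k<N. of_bool (t \<in> I k) / real k) \<le> ?M" for N
    using cantor_point_with_few_visits[where I = I and N = N, OF \<open>D > 0\<close> diam] g_le[of N]
    by (meson order.trans)
  then obtain f where f: "\<And>N. f N \<in> cantor_set"
    and f_le: "\<And>N. (\<Sum>k<N. of_bool (f N \<in> I k) / real k) \<le> ?M"
    by metis
  obtain t r where t: "t \<in> cantor_set" and r: "strict_mono r" "(f \<circ> r) \<longlonglongrightarrow> t"
    using compact_cantor_set f unfolding compact_def by metis
  have "(\<Sum>k<K. of_bool (t \<in> I k) / real k) \<le> ?M" for K
  proof -
    have "\<forall>\<^sub>F j in sequentially. t \<in> I k \<longrightarrow> f (r j) \<in> I k" for k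
      using topological_tendstoD[OF r(2) assms(2)[of k]] by (cases "t \<in> I k") auto
    then have "\<forall>\<^sub>F j in sequentially. \<forall>k\<in>{..<K}. t \<in> I k \<longrightarrow> f (r j) \<in> I k"
      by (intro eventually_ball_finite) auto
    then have "\<forall>\<^sub>F j in sequentially. K \<le> j \<and> (\<forall>k\<in>{..<K}. t \<in> I k \<longrightarrow> f (r j) \<in> I k)"
      using eventually_ge_at_top eventually_conj by blast
    then obtain j where j: "K \<le> j" "\<forall>k\<in>{..<K}. t \<in> I k \<longrightarrow> f (r j) \<in> I k"
      using eventually_happens'[OF sequentially_bot] by blast
    have "K \<le> r j"
      using j(1) seq_suble[OF r(1), of j] by simp
    have "(\<Sum>k<K. of_bool (t \<in> I k) / real k) \<le> (\<Sum>k<K. of_bool (f (r j) \<in> I k) / real k)"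
      using j(2) by (intro sum_mono divide_right_mono) auto
    also have "\<dots> \<le> (\<Sum>k<r j. of_bool (f (r j) \<in> I k) / real k)"
      using \<open>K \<le> r j\<close> by (intro sum_mono2) auto
    also have "\<dots> \<le> ?M"
      by (rule f_le)
    finally show ?thesis .
  qed
  then have "summable (\<lambda>k. of_bool (t \<in> I k) / real k)"
    by (intro summableI_nonneg_bounded) auto
  with t show ?thesis
    by blast
qed

section \<open>Upper density and sums of reciprocals\<close>

text \<open>
  Each element of \<open>A\<close> in \<open>{K..n}\<close> contributes at least \<open>1 / (n + 1)\<close> to the sum of
  reciprocals, so the proportion of such elements is bounded by a tail of the series.
\<close>

lemma upper_density_le_zero_of_summable_reciprocals:
  assumes "summable (\<lambda>k. of_bool (k \<in> A) / real k)"
  shows "upper_density A \<le> 0"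
proof -
  let ?f = "\<lambda>k. of_bool (k \<in> A) / real k"
  let ?d = "\<lambda>n. real (card (A \<inter> {0..n})) / real (n + 1)"
  have "?d \<longlonglongrightarrow> 0"
  proof (rule LIMSEQ_I)
    fix e :: real assume "0 < e"
    then obtain K0 where K0: "\<And>m n. m \<ge> K0 \<Longrightarrow> norm (sum ?f {m..<n}) < e / 2"
      using assms unfolding summable_Cauchy by (meson half_gt_zero)
    \<comment> \<open>The index 0 is kept out of the tail, since \<open>?f 0 = 0\<close> even if \<open>0 \<in> A\<close>.\<close>
    define K where "K = Suc K0"
    obtain L where L: "2 * real K / e < real L"
      using reals_Archimedean2 by blast
    have "norm (?d n - 0) < e" if "n \<ge> max L K" for n
    proof -
      have "A \<inter> {0..n} \<subseteq> {..<K} \<union> (A \<inter> {K..<Suc n})"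
        by auto
      then have "card (A \<inter> {0..n}) \<le> card ({..<K} \<union> (A \<inter> {K..<Suc n}))"
        by (intro card_mono) auto
      also have "\<dots> \<le> K + card (A \<inter> {K..<Suc n})"
        using card_Un_le[of "{..<K}" "A \<inter> {K..<Suc n}"] by simp
      finally have 1: "real (card (A \<inter> {0..n})) \<le> real K + real (card (A \<inter> {K..<Suc n}))"
        by linarith
      have "real (card (A \<inter> {K..<Suc n})) = (\<Sum>k\<in>{K..<Suc n}. of_bool (k \<in> A))"
        by (simp add: Int_commute del: sum.op_ivl_Suc)
      also have "\<dots> \<le> (\<Sum>k\<in>{K..<Suc n}. real (n + 1) * ?f k)"
        by (intro sum_mono) (auto simp: K_def field_simps)
      also have "\<dots> = real (n + 1) * sum ?f {K..<Suc n}"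
        by (simp only: sum_distrib_left)
      also have "\<dots> \<le> real (n + 1) * (e / 2)"
        using K0[of K "Suc n"] by (intro mult_left_mono) (auto simp: K_def)
      finally have 2: "real (card (A \<inter> {K..<Suc n})) \<le> real (n + 1) * (e / 2)" .
      have "2 * real K / e < real (n + 1)"
        using L that by simp
      then have "real K < real (n + 1) * (e / 2)"
        using \<open>0 < e\<close> by (simp add: field_simps)
      with 1 2 have "real (card (A \<inter> {0..n})) < real (n + 1) * e"
        by (simp add: field_simps)
      then show ?thesis
        by (simp add: field_simps)
    qed
    then show "\<exists>N. \<forall>n\<ge>N. norm (?d n - 0) < e"
      by blast
  qed
  then have "(\<lambda>n. ereal (?d n)) \<longlonglongrightarrow> ereal 0"
    by (intro tendsto_intros)
  then show ?thesis
    unfolding upper_density_def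
    by (simp only: lim_imp_Limsup[OF sequentially_bot] ereal_less_eq)
qed

section \<open>Scalar multiples of an operator\<close>

lemma funpow_scaleR_linear:
  fixes T :: "'a::real_vector \<Rightarrow> 'a"
  assumes "linear T"
  shows "((\<lambda>x. l *\<^sub>R T x) ^^ k) u = l ^ k *\<^sub>R (T ^^ k) u"
  by (induction k) (auto simp: linear_scale[OF assms])

text \<open>
  The ratio \<open>y / x\<close> satisfies \<open>(y / x) ^ k < 2\<close>, while Bernoulli's inequality bounds this power from
  below by \<open>1 + k * (y / x - 1)\<close>.
\<close>

lemma power_window_diameter:
  fixes x y c :: real
  assumes "0 < x" "x \<le> y" "1 < x ^ k * c" "y ^ k * c < 2"
  shows "(y - x) * real k < x"
proof -
  have "c > 0"
    using assms by (smt (verit) mult_nonneg_nonpos zero_less_power)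
  have "y ^ k * c < 2 * (x ^ k * c)"
    using assms by linarith
  then have "y ^ k < 2 * x ^ k"
    using \<open>c > 0\<close> by (simp flip: mult.assoc)
  then have "(y / x) ^ k < 2"
    using \<open>0 < x\<close> by (simp add: power_divide field_simps)
  moreover have "1 + real k * ((y - x) / x) \<le> (1 + (y - x) / x) ^ k"
    using assms by (intro Bernoulli_inequality) (smt (verit) divide_nonneg_pos)
  moreover have "1 + (y - x) / x = y / x"
    using \<open>0 < x\<close> by (simp add: field_simps)
  ultimately have "real k * ((y - x) / x) < 1"
    by simp
  then show ?thesis
    using \<open>0 < x\<close> by (simp add: field_simps)
qed

theorem proposition3p17:
  fixes T :: "'a::banach \<Rightarrow> 'a" and a b :: real
  assumes "0 < a" and "a < b"
    and "separable_space (euclidean :: 'a topology)"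
    and "infinite_dimensional TYPE('a)"
    and "bounded_linear T"
  shows "\<not> (\<exists>u. common_upper_freq_hypercyclic (\<lambda>l x. l *\<^sub>R T x) (cantor_set_on a b) u)"
proof
  assume "\<exists>u. common_upper_freq_hypercyclic (\<lambda>l x. l *\<^sub>R T x) (cantor_set_on a b) u"
  then obtain u where
    u: "\<And>l. l \<in> cantor_set_on a b \<Longrightarrow> upper_freq_hypercyclic (\<lambda>x. l *\<^sub>R T x) u"
    unfolding common_upper_freq_hypercyclic_def by blast
  define U :: "'a set" where "U = {x. 1 < norm x \<and> norm x < 2}"
  have "open U"
    unfolding U_def by (intro open_Collect_conj open_Collect_less continuous_intros)
  have "U \<noteq> {}"
  proof -
    have "span {} \<noteq> (UNIV :: 'a set)"
      using assms(4) unfolding infinite_dimensional_def by blast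
    then obtain x :: 'a where "x \<noteq> 0"
      by auto
    then have "(3 / 2 / norm x) *\<^sub>R x \<in> U"
      by (simp add: U_def)
    then show ?thesis
      by blast
  qed
  define l where "l t = a + (b - a) * t" for t
  define I where "I k = {t. l t ^ k *\<^sub>R (T ^^ k) u \<in> U}" for k
  have "open (I k)" for k
    unfolding I_def U_def l_def mem_Collect_eq
    by (intro open_Collect_conj open_Collect_less continuous_intros)
  have l_bounds: "a \<le> l t" "l t \<le> b" if "t \<in> cantor_set" for t
  proof -
    have "0 \<le> t" "t \<le> 1"
      using that cantor_set_subset by auto
    then have "0 \<le> (b - a) * t" "(b - a) * t \<le> (b - a) * 1"
      using \<open>a < b\<close> by (auto intro!: mult_left_mono)
    then show "a \<le> l t" "l t \<le> b"
      unfolding l_def by auto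
  qed
  have diam_ordered: "(t - s) * real k < b / (b - a)"
    if "s \<in> I k \<inter> cantor_set" "t \<in> I k \<inter> cantor_set" "s \<le> t" for s t k
  proof -
    have s: "a \<le> l s" "l s \<le> b" and t: "a \<le> l t"
      using that l_bounds by auto
    have "l s \<le> l t"
      using \<open>a < b\<close> \<open>s \<le> t\<close> unfolding l_def by (simp add: mult_left_mono)
    moreover have "1 < l s ^ k * norm ((T ^^ k) u)" "l t ^ k * norm ((T ^^ k) u) < 2"
      using that s t \<open>0 < a\<close> by (auto simp: I_def U_def power_abs)
    ultimately have "(l t - l s) * real k < l s"
      using s \<open>0 < a\<close> by (intro power_window_diameter) auto
    then have "(b - a) * ((t - s) * real k) < b"
      using s by (simp add: l_def algebra_simps)
    then show ?thesis
      using \<open>a < b\<close> by (simp add: field_simps)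
  qed
  have diam: "\<bar>s - t\<bar> * real k < b / (b - a)"
    if "s \<in> I k \<inter> cantor_set" "t \<in> I k \<inter> cantor_set" for s t k
    using diam_ordered[of s k t] diam_ordered[of t k s] that
    by (cases "s \<le> t") (auto simp: abs_if)
  have "0 < b / (b - a)"
    using assms(1,2) by simp
  then obtain t where t: "t \<in> cantor_set" "summable (\<lambda>k. of_bool (t \<in> I k) / real k)"
    using cantor_point_with_sparse_visits[where I = I, OF _ \<open>\<And>k. open (I k)\<close> diam] by blast
  have "{k. ((\<lambda>x. l t *\<^sub>R T x) ^^ k) u \<in> U} = {k. t \<in> I k}"
    by (simp add: I_def funpow_scaleR_linear bounded_linear.linear[OF assms(5)])
  moreover have "upper_density {k. t \<in> I k} \<le> 0"
    using t(2) by (intro upper_density_le_zero_of_summable_reciprocals) simp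
  moreover have "upper_freq_hypercyclic (\<lambda>x. l t *\<^sub>R T x) u"
    using t(1) by (intro u) (auto simp: cantor_set_on_def l_def)
  moreover from this have "0 < upper_density {k. ((\<lambda>x. l t *\<^sub>R T x) ^^ k) u \<in> U}"
    using \<open>open U\<close> \<open>U \<noteq> {}\<close> unfolding upper_freq_hypercyclic_def by blast
  ultimately show False
    by simp
qed

end
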